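(* Let $m\in(0,1]$, let $h:J\subseteq\mathbb{R}\to\mathbb{R}$ be a non-negative function, and let $f:[0,\infty)\to\mathbb{R}$ be an $(h-m)$-convex function. If $0\le a<b<\infty$ and $f\in L_1[a,b]$, then $$\frac{1}{b-a}\int_a^b f(x)\,dx\le \min\left\{ f(a)\int_0^1 h(t)\,dt+m f\left(\frac{b}{m}\right)\int_0^1 h(1-t)\,dt,\ \ f(b)\int_0^1 h(t)\,dt+m f\left(\frac{a}{m}\right)\int_0^1 h(1-t)\,dt\right\}.$$
   Context: Let $h:J\subseteq\mathbb{R}\to\mathbb{R}$ be a non-negative function, where $J$ is an interval containing $(0,1)$, and let $m\in[0,1]$. A function $f$ defined on $[0,\infty)$ is called $(h-m)$-convex if $f$ is non-negative and for all $x,y\in[0,\infty)$ and all $\alpha\in(0,1)$, $$f(\alpha x+m(1-\alpha)y)\le h(\alpha)f(x)+m\,h(1-\alpha)f(y).$$ Writing $\int_0^1 h(t)\,dt$ presupposes that $h$ is Lebesgue integrable on $(0,1)$. *)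

theory Defs
  imports "HOL-Analysis.Analysis"
begin

text \<open>
  A function on \<open>[0, \<infinity>)\<close> is represented by a total function whose values at negative arguments
  are left unconstrained. Likewise only the values of \<open>h\<close> on \<open>(0, 1)\<close> enter here.
\<close>

definition hm_convex :: "(real \<Rightarrow> real) \<Rightarrow> real \<Rightarrow> (real \<Rightarrow> real) \<Rightarrow> bool" where
  "hm_convex h m f \<longleftrightarrow>
     (\<forall>x\<in>{0..}. 0 \<le> f x) \<and>
     (\<forall>x\<in>{0..}. \<forall>y\<in>{0..}. \<forall>\<alpha>\<in>{0<..<1}.
        f (\<alpha> * x + m * (1 - \<alpha>) * y) \<le> h \<alpha> * f x + m * h (1 - \<alpha>) * f y)"

end

theory Submission
  imports Defs
begin

text \<open>
  Writing \<open>m * (1 - t) * (q / m) = (1 - t) * q\<close>, the defining inequality of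
  \<open>(h, m)\<close>-convexity bounds \<open>f\<close> along the segment from \<open>q\<close> to \<open>p\<close> by a combination of
  \<open>f p\<close> and \<open>f (q / m)\<close> with weights \<open>h t\<close> and \<open>m * h (1 - t)\<close>.
  Integrating over \<open>t\<close> in \<open>(0, 1)\<close> turns the left-hand side into the mean of \<open>f\<close> over the
  segment, by the affine substitution \<open>has_integral_mean_closed_segment\<close>. The parametrisation does
  not care which endpoint comes first, so the two entries of the minimum are the cases
  \<open>(p, q) = (a, b)\<close> and \<open>(p, q) = (b, a)\<close> of the one estimate \<open>hm_convex_mean_le\<close>.
\<close>

text \<open>
  The map \<open>t \<mapsto> q + (p - q) * t\<close> scales lengths by \<open>\<bar>p - q\<bar>\<close>, whichever endpoint is larger.
  Besides the mean of \<open>f\<close>, this covers the reflection \<open>t \<mapsto> 1 - t\<close>, as the case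
  \<open>p = 0\<close>, \<open>q = 1\<close>.
\<close>

lemma has_integral_mean_closed_segment:
  fixes g :: "real \<Rightarrow> real"
  assumes "(g has_integral I) (closed_segment p q)" and "p \<noteq> q"
  shows "((\<lambda>t. g (t * p + (1 - t) * q)) has_integral I / \<bar>p - q\<bar>) {0<..<1}"
proof -
  have "(g has_integral I) (cbox (min p q) (max p q))"
    using assms(1) by (simp add: closed_segment_eq_real_ivl min_def max_def split: if_splits)
  from has_integral_affinity[OF this, of "p - q" q]
  have "((\<lambda>t. g ((p - q) * t + q)) has_integral I / \<bar>p - q\<bar>)
          ((\<lambda>x. x / (p - q) - q / (p - q)) ` {min p q..max p q})"
    using \<open>p \<noteq> q\<close> by simp
  also have "(\<lambda>x. x / (p - q) - q / (p - q)) ` {min p q..max p q} = {0..1}"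
  proof -
    have eq: "(\<lambda>x. x / (p - q) - q / (p - q)) = (\<lambda>x. (1 / (p - q)) * x + (- q / (p - q)))"
      by auto
    show ?thesis
      unfolding eq image_affinity_atLeastAtMost using \<open>p \<noteq> q\<close>
      by (simp add: min_def max_def add_divide_distrib [symmetric] flip: diff_divide_distrib)
  qed
  finally have "((\<lambda>t. g ((p - q) * t + q)) has_integral I / \<bar>p - q\<bar>) {0<..<1}"
    by (simp add: has_integral_Icc_iff_Ioo)
  then show ?thesis
    by (simp add: algebra_simps)
qed

lemma integrable_reflect_unit_interval:
  fixes h :: "real \<Rightarrow> real"
  assumes "h integrable_on {0<..<1}"
  shows "(\<lambda>t. h (1 - t)) integrable_on {0<..<1}"
proof -
  have "(h has_integral integral {0<..<1} h) (closed_segment 0 1)"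
    using assms has_integral_Icc_iff_Ioo[of h _ 0 1]
    by (auto simp: closed_segment_eq_real_ivl)
  from has_integral_mean_closed_segment[OF this] show ?thesis
    by (auto simp: integrable_on_def)
qed

lemma hm_convex_mean_le:
  assumes "0 < m" and hm: "hm_convex h m f"
    and "0 \<le> p" and "0 \<le> q" and "p \<noteq> q"
    and f: "f integrable_on closed_segment p q"
    and h: "h integrable_on {0<..<1}"
  shows "integral (closed_segment p q) f / \<bar>p - q\<bar> \<le>
    f p * integral {0<..<1} h + m * f (q / m) * integral {0<..<1} (\<lambda>t. h (1 - t))"
proof (rule has_integral_le)
  show "((\<lambda>t. f (t * p + (1 - t) * q)) has_integral
      integral (closed_segment p q) f / \<bar>p - q\<bar>) {0<..<1}"
    using f \<open>p \<noteq> q\<close> by (intro has_integral_mean_closed_segment) auto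
  show "((\<lambda>t. f p * h t + m * f (q / m) * h (1 - t)) has_integral
      f p * integral {0<..<1} h + m * f (q / m) * integral {0<..<1} (\<lambda>t. h (1 - t))) {0<..<1}"
    using h integrable_reflect_unit_interval[OF h]
    by (intro has_integral_add has_integral_mult_right) auto
next
  fix t :: real
  assume t: "t \<in> {0<..<1}"
  have "f (t * p + m * (1 - t) * (q / m)) \<le> h t * f p + m * h (1 - t) * f (q / m)"
    using hm t \<open>0 < m\<close> \<open>0 \<le> p\<close> \<open>0 \<le> q\<close> unfolding hm_convex_def
    by (meson atLeast_iff divide_nonneg_pos)
  then show "f (t * p + (1 - t) * q) \<le> f p * h t + m * f (q / m) * h (1 - t)"
    using \<open>0 < m\<close> by (simp add: mult_ac)
qed

theorem theorem8:
  fixes J :: "real set" and h f :: "real \<Rightarrow> real" and m a b :: real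
  assumes "0 < m" and "m \<le> 1"
    and "is_interval J" and "{0<..<1} \<subseteq> J" and "\<forall>t\<in>J. 0 \<le> h t"
    and "set_integrable lebesgue {0<..<1} h"
    and "hm_convex h m f"
    and "0 \<le> a" and "a < b"
    and "set_integrable lebesgue {a..b} f"
  shows "1 / (b - a) * (LINT x:{a..b}|lebesgue. f x) \<le>
    min (f a * (LINT t:{0<..<1}|lebesgue. h t) + m * f (b / m) * (LINT t:{0<..<1}|lebesgue. h (1 - t)))
        (f b * (LINT t:{0<..<1}|lebesgue. h t) + m * f (a / m) * (LINT t:{0<..<1}|lebesgue. h (1 - t)))"
proof -
  have h: "h integrable_on {0<..<1}" and f: "f integrable_on {a..b}"
    using assms by (auto intro: set_lebesgue_integral_eq_integral(1))
  \<comment> \<open>Nonnegativity of \<open>h\<close> upgrades gauge integrability of the reflection to Lebesgue integrability.\<close>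
  have "set_integrable lebesgue {0<..<1} (\<lambda>t. h (1 - t))"
    using integrable_reflect_unit_interval[OF h] assms(4,5)
    by (intro nonnegative_absolutely_integrable_1) (auto simp: subset_eq)
  then have lint: "(LINT t:{0<..<1}|lebesgue. h (1 - t)) = integral {0<..<1} (\<lambda>t. h (1 - t))"
    "(LINT t:{0<..<1}|lebesgue. h t) = integral {0<..<1} h"
    "(LINT x:{a..b}|lebesgue. f x) = integral {a..b} f"
    using assms by (auto intro: set_lebesgue_integral_eq_integral(2))
  have seg: "closed_segment a b = {a..b}" "closed_segment b a = {a..b}"
    using \<open>a < b\<close> by (auto simp: closed_segment_eq_real_ivl)
  show ?thesis
    using hm_convex_mean_le[OF assms(1,7), of a b] hm_convex_mean_le[OF assms(1,7), of b a]
      assms(8,9) f h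
    by (simp add: lint seg)
qed

end
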